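(* Let $R>1$ and $c\ge 0$, and let $T\in\mathbb{DLA}_R(c)$ be a $2\times2$ complex matrix with a single eigenvalue. Then $\overline{A_R}$ is a $K(R)$-spectral set for $T$, where $$K(R)=2+c\,\frac{R^2-1}{R^2+1}\le 2+c.$$
   Context: The annulus is $A_R=\{z\in\mathbb{C}:1/R<|z|<R\}$, with closure $\overline{A_R}=\{1/R\le|z|\le R\}$; $\mathbb{D}$ is the open unit disk. For an operator $X$ on a complex Hilbert space, $\Re X=\frac12(X+X^* )$, and $X\ge0$ means $X$ is a positive operator. Class $\mathbb{DLA}_R(c)$ ($R>1$, $c\in\mathbb{R}$): all bounded Hilbert space operators $T$ such that (i) $\sigma(T)\subset\overline{A_R}$, and (ii) $2\Re\big[(1-zT/R)^{-1}+(1-wT^{-1}/R)^{-1}\big]-2+c\ge0$ for all $z,w\in\mathbb{D}$. $2\times 2$ matrices are regarded as operators on the Hilbert space $\mathbb{C}^2$. For a compact set $X\subset\mathbb{C}$ and an operator $T$ with $\sigma(T)\subset X$, $X$ is a $K$-spectral set for $T$ if $\|f(T)\|\le K\sup_{z\in X}|f(z)|$ for every rational function $f$ with poles off $X$. *)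

theory Defs
  imports "HOL-Analysis.Analysis" "HOL-Computational_Algebra.Polynomial"
begin

text \<open>
  Operators on the Hilbert space \<open>\<complex>\<^sup>n\<close> are square complex matrices acting by \<open>*v\<close>. The norm of
  type \<^typ>\<open>complex ^ 'n\<close> is the Euclidean one, so \<open>onorm ((*v) A)\<close> is the operator norm of \<open>A\<close>.
  The library's \<open>\<bullet>\<close> on this type is only the real part of the Hermitian inner product.
  The library's \<open>*\<close> and \<open>^\<close> on matrices act entrywise, hence \<open>**\<close> and iterated \<open>**\<close> below;
  the scalar multiple of \<open>A\<close> by \<open>a\<close> is written \<open>mat a ** A\<close>.
\<close>

definition cinner :: "complex ^ 'n \<Rightarrow> complex ^ 'n \<Rightarrow> complex" where
  "cinner x y = (\<Sum>i\<in>UNIV. x $ i * cnj (y $ i))"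

definition cadjoint :: "complex ^ 'n ^ 'm \<Rightarrow> complex ^ 'm ^ 'n" where
  "cadjoint A = map_matrix cnj (transpose A)"

lemma cinner_self: "cinner x x = of_real ((norm x)\<^sup>2)"
  by (simp add: cinner_def norm_vec_def L2_set_def sum_nonneg complex_norm_square
      del: of_real_power)

lemma cinner_cadjoint: "cinner (A *v x) y = cinner x (cadjoint A *v y)"
proof -
  have "cinner (A *v x) y = (\<Sum>i\<in>UNIV. \<Sum>j\<in>UNIV. A $ i $ j * x $ j * cnj (y $ i))"
    by (simp add: cinner_def matrix_vector_mult_def sum_distrib_right)
  also have "\<dots> = (\<Sum>j\<in>UNIV. \<Sum>i\<in>UNIV. A $ i $ j * x $ j * cnj (y $ i))"
    by (rule sum.swap)
  also have "\<dots> = cinner x (cadjoint A *v y)"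
    by (simp add: cinner_def cadjoint_def matrix_vector_mult_def transpose_def
        sum_distrib_left mult_ac)
  finally show ?thesis .
qed

definition re_part :: "complex ^ 'n ^ 'n \<Rightarrow> complex ^ 'n ^ 'n" where
  "re_part X = (1 / 2) *\<^sub>R (X + cadjoint X)"

definition positive_op :: "complex ^ 'n ^ 'n \<Rightarrow> bool" where
  "positive_op X \<longleftrightarrow> (\<forall>h. cinner (X *v h) h \<in> \<real>\<^sub>\<ge>\<^sub>0)"

definition spectrum :: "complex ^ 'n ^ 'n \<Rightarrow> complex set" where
  "spectrum T = {\<mu>. \<not> invertible (T - mat \<mu>)}"

definition is_eigenvalue :: "complex ^ 'n ^ 'n \<Rightarrow> complex \<Rightarrow> bool" where
  "is_eigenvalue T \<mu> \<longleftrightarrow> (\<exists>v. v \<noteq> 0 \<and> T *v v = \<mu> *s v)"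

definition closed_annulus :: "real \<Rightarrow> complex set" where
  "closed_annulus R = {z. 1 / R \<le> norm z \<and> norm z \<le> R}"

text \<open>The members of the class \<open>DLA\<^sub>R(c)\<close> that act on \<open>\<complex>\<^sup>n\<close>. The first condition makes all the
  inverses in the second one genuine when \<open>R > 1\<close>.\<close>

definition DLA :: "real \<Rightarrow> real \<Rightarrow> (complex ^ 'n ^ 'n) set" where
  "DLA R c = {T. spectrum T \<subseteq> closed_annulus R \<and>
     (\<forall>z \<in> ball 0 1. \<forall>w \<in> ball 0 1.
        positive_op
          (2 *\<^sub>R re_part (matrix_inv (mat 1 - mat (z / of_real R) ** T)
                      + matrix_inv (mat 1 - mat (w / of_real R) ** matrix_inv T))
           - mat 2 + mat (of_real c)))}"

definition poly_mat :: "complex poly \<Rightarrow> complex ^ 'n ^ 'n \<Rightarrow> complex ^ 'n ^ 'n" where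
  "poly_mat p T = (\<Sum>i\<le>degree p. mat (coeff p i) ** (((**) T ^^ i) (mat 1)))"

text \<open>A rational function with poles off \<open>X\<close> is a quotient \<open>p / q\<close> of polynomials with \<open>q\<close> zero-free
  on \<open>X\<close>; if \<open>X\<close> contains the spectrum of \<open>T\<close>, then \<open>q(T)\<close> is invertible and \<open>f(T) = p(T) q(T)\<^sup>-\<^sup>1\<close>.\<close>

definition K_spectral_set :: "complex set \<Rightarrow> real \<Rightarrow> complex ^ 'n ^ 'n \<Rightarrow> bool" where
  "K_spectral_set X K T \<longleftrightarrow> compact X \<and> spectrum T \<subseteq> X \<and>
     (\<forall>p q. (\<forall>z\<in>X. poly q z \<noteq> 0) \<longrightarrow>
        onorm ((*v) (poly_mat p T ** matrix_inv (poly_mat q T)))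
          \<le> K * (SUP z\<in>X. norm (poly p z / poly q z)))"

end

theory Submission
  imports Defs "HOL-Complex_Analysis.Complex_Analysis"
begin

text \<open>
  A two-by-two matrix with the single eigenvalue \<open>\<mu>\<close> is \<open>T = \<mu> + N\<close> with \<open>N\<^sup>2 = 0\<close>, so
  \<open>f(T) = f(\<mu>) + f'(\<mu>) N\<close>: the theorem is a bound on derivatives. In a suitable orthonormal
  basis \<open>f(T)\<close> is upper triangular with diagonal \<open>f(\<mu>)\<close> and corner \<open>f'(\<mu>) a\<close>, where
  \<open>a\<close> is the norm of \<open>N\<close>. For \<open>|f| < 1\<close> on the annulus, such a matrix has norm at most \<open>K\<close>
  as soon as \<open>a |f'(\<mu>)| \<le> K (1 - |f(\<mu>)|\<^sup>2)\<close> (\<open>jet_norm_bound\<close>).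

  Write \<open>s = |\<mu>| / R\<close> and \<open>r = 1 / (R |\<mu>|)\<close>, so that \<open>s r = 1 / R\<^sup>2\<close>. Cauchy's formula on
  the two boundary circles, with the integrals of \<open>1 / |z - \<mu>|\<^sup>2\<close> evaluated as Poisson integrals,
  gives \<open>|\<mu>| |f'(\<mu>)| \<le> s / (1 - s\<^sup>2) + r / (1 - r\<^sup>2)\<close>. A disc automorphism
  improves this by the factor \<open>1 - |f(\<mu>)|\<^sup>2\<close> (\<open>annulus_schwarz_pick\<close>).

  The positivity condition of the class says, for a Jordan block, that the corner of the operator
  is dominated by its diagonal. It suffices to use this for two pairs \<open>(z, w)\<close> of boundary
  points, those with \<open>z \<mu> / R = \<plusminus> s\<close> and \<open>w / (R \<mu>) = \<mp> r\<close>. With \<open>p = (1 - s) (1 + r)\<close>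
  and \<open>q = (1 + s) (1 - r)\<close> they read
  \<open>(a / |\<mu>|) (s + r) / p \<le> 2 + c p / (1 + s r)\<close>, and the same for \<open>q\<close>. Their arithmetic mean is
  \<open>(a / |\<mu>|) (s / (1 - s\<^sup>2) + r / (1 - r\<^sup>2)) \<le> 2 + c (1 - s r) / (1 + s r)\<close>
  (\<open>averaged_inequality\<close>): on the left is the bound for \<open>a |f'(\<mu>)|\<close>, and on the right is
  \<open>K(R)\<close>. If \<open>\<mu>\<close> lies on the boundary of the annulus, then \<open>p\<close> or \<open>q\<close> is zero, and the positivity
  condition forces \<open>N = 0\<close>.
\<close>

section \<open>Bounded holomorphic functions on an annulus\<close>

text \<open>
  The Poisson kernel of the circle, integrated. On \<open>|z| = \<rho>\<close> one has \<open>cnj z = \<rho>\<^sup>2 / z\<close>, hence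
  \<open>z * |z - \<mu>|\<^sup>2 = (z - \<mu>) * (\<rho>\<^sup>2 - cnj \<mu> * z)\<close>, and the integral becomes a contour integral of a
  rational function with the two poles \<open>\<mu>\<close> and \<open>\<rho>\<^sup>2 / cnj \<mu>\<close>. These are mirror images in the
  circle, so exactly one of them lies inside.
\<close>

lemma poisson_circle_integral:
  fixes \<mu> :: complex and \<rho> :: real
  assumes \<rho>: "\<rho> > 0" and \<mu>: "\<mu> \<noteq> 0" "norm \<mu> \<noteq> \<rho>"
  shows "((\<lambda>t. 2 * pi * \<rho> / (norm (circlepath 0 \<rho> t - \<mu>))\<^sup>2)
           has_integral (2 * pi * \<rho> / \<bar>\<rho>\<^sup>2 - (norm \<mu>)\<^sup>2\<bar>)) {0..1}"
proof -
  let ?k = "\<lambda>z. 1 / ((z - \<mu>) * (of_real (\<rho>\<^sup>2) - cnj \<mu> * z))"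
  define J where "J = 2 * complex_of_real pi * \<i> / of_real \<bar>\<rho>\<^sup>2 - (norm \<mu>)\<^sup>2\<bar>"
  have ksum: "cnj \<mu> * \<mu> = of_real ((norm \<mu>)\<^sup>2)"
    by (metis complex_norm_square mult.commute)
  have "(?k has_contour_integral J) (circlepath 0 \<rho>)"
  proof (cases "norm \<mu> < \<rho>")
    case True
    have nz: "of_real (\<rho>\<^sup>2) - cnj \<mu> * z \<noteq> 0" if "z \<in> cball 0 \<rho>" for z
    proof
      assume "of_real (\<rho>\<^sup>2) - cnj \<mu> * z = 0"
      then have "norm (cnj \<mu> * z) = norm (complex_of_real (\<rho>\<^sup>2))" by simp
      then have "norm \<mu> * norm z = \<rho>\<^sup>2" by (simp add: norm_mult norm_power)
      moreover have "norm \<mu> * norm z \<le> norm \<mu> * \<rho>" using that by (simp add: mult_left_mono)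
      moreover have "norm \<mu> * \<rho> < \<rho> * \<rho>" using True \<rho> by simp
      ultimately show False by (simp add: power2_eq_square)
    qed
    have "((\<lambda>u. (1 / (of_real (\<rho>\<^sup>2) - cnj \<mu> * u)) / (u - \<mu>)) has_contour_integral
            2 * of_real pi * \<i> * (1 / (of_real (\<rho>\<^sup>2) - cnj \<mu> * \<mu>))) (circlepath 0 \<rho>)"
      by (rule Cauchy_integral_circlepath_simple)
         (use nz True in \<open>auto intro!: holomorphic_intros simp del: of_real_power\<close>)
    moreover have "\<bar>\<rho>\<^sup>2 - (norm \<mu>)\<^sup>2\<bar> = \<rho>\<^sup>2 - (norm \<mu>)\<^sup>2"
      using True \<rho> by (simp add: power_mono)
    ultimately show ?thesis
      unfolding J_def ksum by (simp add: mult.commute)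
  next
    case False
    then have lt: "\<rho> < norm \<mu>" using \<mu> by simp
    define \<nu> where "\<nu> = of_real (\<rho>\<^sup>2) / cnj \<mu>"
    have n\<nu>: "norm \<nu> < \<rho>"
      using lt \<rho> \<mu> by (simp add: \<nu>_def norm_divide norm_mult power2_eq_square field_simps)
    have nz: "z - \<mu> \<noteq> 0" if "z \<in> cball 0 \<rho>" for z using that lt by auto
    have "((\<lambda>u. (- 1 / (cnj \<mu> * (u - \<mu>))) / (u - \<nu>)) has_contour_integral
            2 * of_real pi * \<i> * (- 1 / (cnj \<mu> * (\<nu> - \<mu>)))) (circlepath 0 \<rho>)"
      by (rule Cauchy_integral_circlepath_simple)
         (use nz n\<nu> \<mu> in \<open>auto intro!: holomorphic_intros\<close>)
    moreover have "(- 1 / (cnj \<mu> * (u - \<mu>))) / (u - \<nu>) = ?k u" for u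
    proof -
      have "cnj \<mu> * (u - \<nu>) = - (of_real (\<rho>\<^sup>2) - cnj \<mu> * u)"
        using \<mu> by (simp add: \<nu>_def field_simps)
      then show ?thesis
        by (metis (no_types, lifting) divide_divide_eq_left minus_divide_divide minus_minus
            mult.commute mult.left_commute mult_minus_right)
    qed
    moreover have "cnj \<mu> * (\<nu> - \<mu>) = of_real (\<rho>\<^sup>2 - (norm \<mu>)\<^sup>2)"
      using \<mu> ksum by (simp add: \<nu>_def field_simps)
    moreover have "\<bar>\<rho>\<^sup>2 - (norm \<mu>)\<^sup>2\<bar> = (norm \<mu>)\<^sup>2 - \<rho>\<^sup>2"
      using lt \<rho> by (simp add: power_mono)
    ultimately show ?thesis
      unfolding J_def by (simp add: field_simps flip: minus_divide_right) (simp add: minus_divide_right)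
  qed
  then have "((\<lambda>t. ?k (circlepath 0 \<rho> t) * vector_derivative (circlepath 0 \<rho>) (at t))
              has_integral J) {0..1}"
    by (simp add: has_contour_integral)
  then have "((\<lambda>t. \<rho> / \<i> * (?k (circlepath 0 \<rho> t) * vector_derivative (circlepath 0 \<rho>) (at t)))
              has_integral (\<rho> / \<i> * J)) {0..1}"
    by (rule has_integral_mult_right)
  moreover have "\<rho> / \<i> * (?k (circlepath 0 \<rho> t) * vector_derivative (circlepath 0 \<rho>) (at t))
      = of_real (2 * pi * \<rho> / (norm (circlepath 0 \<rho> t - \<mu>))\<^sup>2)" for t
  proof -
    define z where "z = circlepath 0 \<rho> t"
    have nz: "norm z = \<rho>" using \<rho> by (simp add: z_def circlepath norm_mult)
    then have z0: "z \<noteq> 0" using \<rho> by auto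
    have zz: "z * cnj z = of_real (\<rho>\<^sup>2)" using nz by (metis complex_norm_square)
    have "vector_derivative (circlepath 0 \<rho>) (at t) = 2 * of_real pi * \<i> * z"
      by (simp only: vector_derivative_circlepath) (simp add: z_def circlepath)
    moreover have "(z - \<mu>) * (of_real (\<rho>\<^sup>2) - cnj \<mu> * z) = z * of_real ((norm (z - \<mu>))\<^sup>2)"
      unfolding complex_norm_square zz[symmetric] by (simp add: algebra_simps)
    ultimately show ?thesis using z0
      by (simp add: z_def[symmetric] field_simps del: of_real_power)
  qed
  moreover have "\<rho> / \<i> * J = of_real (2 * pi * \<rho> / \<bar>\<rho>\<^sup>2 - (norm \<mu>)\<^sup>2\<bar>)"
    by (simp add: J_def mult_ac)
  ultimately have "((\<lambda>t. complex_of_real (2 * pi * \<rho> / (norm (circlepath 0 \<rho> t - \<mu>))\<^sup>2))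
           has_integral of_real (2 * pi * \<rho> / \<bar>\<rho>\<^sup>2 - (norm \<mu>)\<^sup>2\<bar>)) {0..1}"
    by (simp only:)
  from has_integral_linear[OF this bounded_linear_Re] show ?thesis
    by (simp only: o_def Re_complex_of_real)
qed

lemma contour_integral_square_kernel_bound:
  fixes \<mu> :: complex and \<rho> :: real
  assumes \<rho>: "\<rho> > 0" and \<mu>: "\<mu> \<noteq> 0" "norm \<mu> \<noteq> \<rho>"
    and bd: "\<And>z. norm z = \<rho> \<Longrightarrow> norm (f z) \<le> M"
    and int: "((\<lambda>z. f z / (z - \<mu>)\<^sup>2) has_contour_integral I) (circlepath 0 \<rho>)"
  shows "norm I \<le> M * (2 * pi * \<rho> / \<bar>\<rho>\<^sup>2 - (norm \<mu>)\<^sup>2\<bar>)"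
proof -
  have i1: "((\<lambda>t. f (circlepath 0 \<rho> t) / (circlepath 0 \<rho> t - \<mu>)\<^sup>2 * vector_derivative (circlepath 0 \<rho>) (at t))
         has_integral I) {0..1}"
    using int by (simp add: has_contour_integral)
  have i2: "((\<lambda>t. M * (2 * pi * \<rho> / (norm (circlepath 0 \<rho> t - \<mu>))\<^sup>2))
           has_integral (M * (2 * pi * \<rho> / \<bar>\<rho>\<^sup>2 - (norm \<mu>)\<^sup>2\<bar>))) {0..1}"
    by (rule has_integral_mult_right[OF poisson_circle_integral[OF \<rho> \<mu>]])
  have "norm (f (circlepath 0 \<rho> t) / (circlepath 0 \<rho> t - \<mu>)\<^sup>2 * vector_derivative (circlepath 0 \<rho>) (at t))
       \<le> M * (2 * pi * \<rho> / (norm (circlepath 0 \<rho> t - \<mu>))\<^sup>2)" for t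
  proof -
    have "norm (circlepath 0 \<rho> t) = \<rho>" using \<rho> by (simp add: circlepath norm_mult)
    then have "norm (f (circlepath 0 \<rho> t)) * (2 * pi * \<rho> / (norm (circlepath 0 \<rho> t - \<mu>))\<^sup>2)
        \<le> M * (2 * pi * \<rho> / (norm (circlepath 0 \<rho> t - \<mu>))\<^sup>2)"
      by (intro mult_right_mono bd) (use \<rho> in auto)
    then show ?thesis
      using \<rho> by (simp add: vector_derivative_circlepath norm_mult norm_divide norm_power)
  qed
  then show ?thesis
    using has_integral_norm_bound_integral_component[OF i1 i2, of 1] by simp
qed

text \<open>
  Cauchy's formula writes \<open>2 \<pi> \<i> f'(\<mu>)\<close> as the difference of the integrals of
  \<open>f z / (z - \<mu>)\<^sup>2\<close> over the two boundary circles; each of them is estimated by the Poisson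
  integral. To get the formula, the second-order Taylor remainder of \<open>f\<close> at \<open>\<mu>\<close> divided by
  \<open>(z - \<mu>)\<^sup>2\<close> is holomorphic across \<open>\<mu>\<close>, so it has the same integral over both circles.
\<close>

lemma annulus_derivative_bound:
  fixes R :: real and \<mu> :: complex
  assumes R: "R > 1" and \<mu>: "1 / R < norm \<mu>" "norm \<mu> < R"
    and U: "open U" "closed_annulus R \<subseteq> U" and hol: "f holomorphic_on U"
    and bd: "\<And>z. z \<in> closed_annulus R \<Longrightarrow> norm (f z) \<le> M"
  shows "norm (deriv f \<mu>)
      \<le> M * (R / (R\<^sup>2 - (norm \<mu>)\<^sup>2) + (1 / R) / ((norm \<mu>)\<^sup>2 - (1 / R)\<^sup>2))"
proof -
  note U = U[unfolded closed_annulus_def] and bd = bd[unfolded closed_annulus_def mem_Collect_eq]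
  have R1: "0 < 1 / R" "1 / R < R" using R by (auto simp: field_simps) (smt (verit) mult_less_cancel_left2)
  have \<mu>0: "\<mu> \<noteq> 0" using \<mu> R1 by auto
  have \<mu>U: "\<mu> \<in> U" using U \<mu> by auto
  define g where "g = (\<lambda>z. if z = \<mu> then deriv f \<mu> else (f z - f \<mu>) / (z - \<mu>))"
  define h where "h = (\<lambda>z. if z = \<mu> then deriv g \<mu> else (g z - g \<mu>) / (z - \<mu>))"
  have g: "g holomorphic_on U" unfolding g_def by (rule pole_lemma_open[OF hol U(1)])
  have h: "h holomorphic_on U" unfolding h_def by (rule pole_lemma_open[OF g U(1)])
  have split: "f z / (z - \<mu>)\<^sup>2 = h z + (deriv f \<mu> / (z - \<mu>) + f \<mu> / (z - \<mu>)\<^sup>2)" if "z \<noteq> \<mu>" for z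
    using that by (simp add: h_def g_def divide_simps) (simp add: algebra_simps power2_eq_square)
  have norm_cp: "norm (circlepath 0 \<rho> t) = \<rho>" if "\<rho> > 0" for \<rho> t
    using that by (simp add: circlepath norm_mult)
  have "homotopic_loops U (circlepath 0 R) (circlepath 0 (1 / R))"
  proof (rule homotopic_loops_linear)
    fix t x :: real
    let ?e = "exp (2 * of_real pi * \<i> * of_real t) :: complex"
    show "closed_segment (circlepath 0 R t) (circlepath 0 (1 / R) t) \<subseteq> U"
    proof
      fix y assume "y \<in> closed_segment (circlepath 0 R t) (circlepath 0 (1 / R) t)"
      then obtain u where u: "0 \<le> u" "u \<le> 1"
        and y: "y = (1 - u) *\<^sub>R circlepath 0 R t + u *\<^sub>R circlepath 0 (1 / R) t"
        by (auto simp: closed_segment_def)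
      have "y = of_real ((1 - u) * R + u * (1 / R)) * ?e"
        unfolding y by (simp add: circlepath scaleR_conv_of_real algebra_simps)
      moreover have "norm ?e = 1" by simp
      moreover have pos: "0 \<le> (1 - u) * R + u * (1 / R)"
        using u R R1 by (intro add_nonneg_nonneg mult_nonneg_nonneg) auto
      ultimately have "norm y = (1 - u) * R + u * (1 / R)"
        by (simp only: norm_mult norm_of_real) simp
      moreover have "(1 - u) * R + u * (1 / R) \<le> R" "1 / R \<le> (1 - u) * R + u * (1 / R)"
        using u R1 convex_bound_le[of "R" R "1/R" "1-u" u] convex_bound_le[of "-R" "-(1/R)" "-(1/R)" "1-u" u] by auto
      ultimately show "y \<in> U" using U by auto
    qed
  qed auto
  then have heq: "contour_integral (circlepath 0 R) h = contour_integral (circlepath 0 (1 / R)) h"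
    by (rule Cauchy_theorem_homotopic_loops[OF _ U(1) h]) auto
  define I where "I = contour_integral (circlepath 0 R) h"
  have circ: "path_image (circlepath 0 \<rho>) \<subseteq> U" if "1 / R \<le> \<rho>" "\<rho> \<le> R" for \<rho>
  proof -
    have "0 \<le> \<rho>" using that R1 by linarith
    then show ?thesis using that U by auto
  qed
  have inth: "(h has_contour_integral I) (circlepath 0 \<rho>)" if "\<rho> = R \<or> \<rho> = 1 / R" for \<rho>
  proof -
    have "h contour_integrable_on circlepath 0 \<rho>"
      using that R1 by (intro contour_integrable_holomorphic_simple[OF h U(1)] circ) auto
    then show ?thesis
      using that heq unfolding I_def by (metis has_contour_integral_integral)
  qed
  have out: "((\<lambda>z. f z / (z - \<mu>)\<^sup>2) has_contour_integral (I + 2 * of_real pi * \<i> * deriv f \<mu>)) (circlepath 0 R)"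
  proof -
    have "((\<lambda>z. deriv f \<mu> / (z - \<mu>)) has_contour_integral (2 * of_real pi * \<i> * deriv f \<mu>)) (circlepath 0 R)"
      by (rule Cauchy_integral_circlepath_simple) (use \<mu> in auto)
    moreover have "((\<lambda>z. f \<mu> / (z - \<mu>)\<^sup>2) has_contour_integral 0) (circlepath 0 R)"
      using Cauchy_has_contour_integral_higher_derivative_circlepath[of 0 R "\<lambda>_. f \<mu>" \<mu> 1] \<mu>
      by (simp add: power2_eq_square)
    ultimately have "((\<lambda>z. h z + (deriv f \<mu> / (z - \<mu>) + f \<mu> / (z - \<mu>)\<^sup>2)) has_contour_integral
         (I + (2 * of_real pi * \<i> * deriv f \<mu> + 0))) (circlepath 0 R)"
      by (intro has_contour_integral_add inth) auto
    then show ?thesis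
      unfolding add_0_right
    proof (rule has_contour_integral_eq)
      fix z assume "z \<in> path_image (circlepath 0 R)"
      then have "z \<noteq> \<mu>" using \<mu> R R1 by auto
      then show "h z + (deriv f \<mu> / (z - \<mu>) + f \<mu> / (z - \<mu>)\<^sup>2) = f z / (z - \<mu>)\<^sup>2"
        by (rule split[symmetric])
    qed
  qed
  have inn: "((\<lambda>z. f z / (z - \<mu>)\<^sup>2) has_contour_integral I) (circlepath 0 (1 / R))"
  proof -
    have "((\<lambda>z. deriv f \<mu> / (z - \<mu>) + f \<mu> / (z - \<mu>)\<^sup>2) has_contour_integral 0) (circlepath 0 (1 / R))"
      by (rule Cauchy_theorem_disc_simple[of _ 0 "norm \<mu>"])
         (use \<mu> R1 in \<open>auto intro!: holomorphic_intros\<close>)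
    then have "((\<lambda>z. h z + (deriv f \<mu> / (z - \<mu>) + f \<mu> / (z - \<mu>)\<^sup>2)) has_contour_integral (I + 0))
         (circlepath 0 (1 / R))"
      by (intro has_contour_integral_add inth) auto
    then show ?thesis
      unfolding add_0_right
    proof (rule has_contour_integral_eq)
      fix z assume "z \<in> path_image (circlepath 0 (1 / R))"
      then have "z \<noteq> \<mu>" using \<mu> R R1 by auto
      then show "h z + (deriv f \<mu> / (z - \<mu>) + f \<mu> / (z - \<mu>)\<^sup>2) = f z / (z - \<mu>)\<^sup>2"
        by (rule split[symmetric])
    qed
  qed
  have abs1: "\<bar>R\<^sup>2 - (norm \<mu>)\<^sup>2\<bar> = R\<^sup>2 - (norm \<mu>)\<^sup>2"
    using \<mu> R by (simp add: power_mono)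
  have abs2: "\<bar>(1 / R)\<^sup>2 - (norm \<mu>)\<^sup>2\<bar> = (norm \<mu>)\<^sup>2 - (1 / R)\<^sup>2"
    using power_mono[of "1/R" "norm \<mu>" 2] \<mu> R1 by linarith
  have b1: "norm (I + 2 * of_real pi * \<i> * deriv f \<mu>) \<le> M * (2 * pi * R / (R\<^sup>2 - (norm \<mu>)\<^sup>2))"
  proof -
    have "norm (f z) \<le> M" if "norm z = R" for z using bd[of z] that R1 by simp
    from contour_integral_square_kernel_bound[OF _ \<mu>0 _ this out] show ?thesis
      using R \<mu> abs1 by simp
  qed
  have b2: "norm I \<le> M * (2 * pi * (1 / R) / ((norm \<mu>)\<^sup>2 - (1 / R)\<^sup>2))"
  proof -
    have "norm (f z) \<le> M" if "norm z = 1 / R" for z using bd[of z] that R1 by simp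
    from contour_integral_square_kernel_bound[OF R1(1) \<mu>0 _ this inn] show ?thesis
      unfolding abs2 using \<mu> by simp
  qed
  have "2 * pi * norm (deriv f \<mu>) = norm (2 * of_real pi * \<i> * deriv f \<mu>)"
    by (simp add: norm_mult)
  also have "\<dots> \<le> norm (I + 2 * of_real pi * \<i> * deriv f \<mu>) + norm I"
    by (metis add_diff_cancel_left' norm_triangle_ineq4)
  also have "\<dots> \<le> 2 * pi * (M * (R / (R\<^sup>2 - (norm \<mu>)\<^sup>2) + (1 / R) / ((norm \<mu>)\<^sup>2 - (1 / R)\<^sup>2)))"
    using b1 b2 by (simp add: algebra_simps)
  finally show ?thesis by simp
qed

text \<open>
  Composition of \<open>f\<close> with the disc automorphism that sends \<open>f \<mu>\<close> to \<open>0\<close> divides the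
  derivative at \<open>\<mu>\<close> by \<open>1 - |f \<mu>|\<^sup>2\<close>, and the result is still bounded by \<open>1\<close>.
\<close>

lemma annulus_schwarz_pick:
  fixes R :: real and \<mu> :: complex
  assumes R: "R > 1" and \<mu>: "1 / R < norm \<mu>" "norm \<mu> < R"
    and U: "open U" "closed_annulus R \<subseteq> U" and hol: "f holomorphic_on U"
    and bd: "\<And>z. z \<in> closed_annulus R \<Longrightarrow> norm (f z) < 1"
  shows "norm (deriv f \<mu>)
      \<le> (1 - (norm (f \<mu>))\<^sup>2) * (R / (R\<^sup>2 - (norm \<mu>)\<^sup>2) + (1 / R) / ((norm \<mu>)\<^sup>2 - (1 / R)\<^sup>2))"
    (is "_ \<le> _ * ?L")
proof -
  have \<mu>X: "\<mu> \<in> closed_annulus R" using \<mu> by (simp add: closed_annulus_def)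
  define w where "w = f \<mu>"
  have w1: "norm w < 1" using bd[OF \<mu>X] by (simp add: w_def)
  define V where "V = U \<inter> f -` {u. cnj w * u \<noteq> 1}"
  have oV: "open V"
    unfolding V_def using U(1) holomorphic_on_imp_continuous_on[OF hol]
    by (intro continuous_open_preimage) (auto intro!: open_Collect_neq continuous_intros)
  have ne1: "cnj w * u \<noteq> 1" if "norm u < 1" for u
    using that w1 by (metis complex_mod_cnj norm_mult norm_mult_less norm_one mult_1 order_less_irrefl)
  have sub: "closed_annulus R \<subseteq> V"
    using U(2) bd ne1 by (auto simp: V_def)
  define g where "g = (\<lambda>z. (f z - w) / (1 - cnj w * f z))"
  have holV: "f holomorphic_on V" using hol by (rule holomorphic_on_subset) (auto simp: V_def)
  then have g: "g holomorphic_on V"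
    unfolding g_def by (intro holomorphic_intros) (auto simp: V_def)
  have "norm (g z) \<le> 1" if "z \<in> closed_annulus R" for z
    using Moebius_function_norm_lt_1[OF w1 bd[OF that], of 0] by (simp add: g_def Moebius_function_simple)
  then have dg: "norm (deriv g \<mu>) \<le> ?L"
    using annulus_derivative_bound[OF R \<mu> oV sub g, of 1] by simp
  have \<mu>V: "\<mu> \<in> V" using sub \<mu>X by auto
  have df: "(f has_field_derivative deriv f \<mu>) (at \<mu>)"
    using holV oV \<mu>V holomorphic_derivI by blast
  have ww: "1 - cnj w * w = of_real (1 - (norm w)\<^sup>2)"
    by (metis complex_norm_square mult.commute of_real_1 of_real_diff)
  have pos: "0 < 1 - (norm w)\<^sup>2" using w1 by (simp add: power_less_one_iff abs_square_less_1)
  have "(g has_field_derivative (deriv f \<mu> / (1 - cnj w * w))) (at \<mu>)"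
  proof -
    have nz: "1 - cnj w * w \<noteq> 0" using ne1[OF w1] by simp
    have "(g has_field_derivative (((deriv f \<mu> - 0) * (1 - cnj w * f \<mu>)
             - (f \<mu> - w) * (0 - cnj w * deriv f \<mu>)) / ((1 - cnj w * f \<mu>) * (1 - cnj w * f \<mu>)))) (at \<mu>)"
      unfolding g_def
    proof (intro DERIV_divide DERIV_diff DERIV_const DERIV_cmult df)
      show "1 - cnj w * f \<mu> \<noteq> 0" using nz by (simp add: w_def)
    qed
    then show ?thesis using nz by (simp add: w_def[symmetric])
  qed
  then have "deriv g \<mu> = deriv f \<mu> / of_real (1 - (norm w)\<^sup>2)"
    unfolding ww by (rule DERIV_imp_deriv)
  then have "norm (deriv g \<mu>) = norm (deriv f \<mu>) / (1 - (norm w)\<^sup>2)"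
    using pos by (simp only: norm_divide norm_of_real)
  then have "norm (deriv f \<mu>) = (1 - (norm w)\<^sup>2) * norm (deriv g \<mu>)"
    using pos by simp
  also have "\<dots> \<le> (1 - (norm w)\<^sup>2) * ?L"
    using dg pos by (intro mult_left_mono) auto
  finally show ?thesis by (simp add: w_def)
qed

section \<open>Functions of a matrix with one eigenvalue\<close>

lemma mat_mul_mat: "mat a ** mat b = (mat (a * b) :: 'a::comm_semiring_1 ^ 'n ^ 'n)"
  by (simp add: matrix_matrix_mult_def mat_def vec_eq_iff if_distrib[of "\<lambda>x. x * _"] cong: if_cong)

lemma mat_mul_commute: "A ** mat b = mat b ** (A :: 'a::comm_semiring_1 ^ 'n ^ 'n)"
  by (simp add: matrix_matrix_mult_def mat_def vec_eq_iff if_distrib[of "\<lambda>x. x * _"]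
      if_distrib[of "\<lambda>x. _ * x"] mult.commute cong: if_cong)

lemma mat_add: "mat (a + b) = mat a + (mat b :: 'a::semiring_1 ^ 'n ^ 'n)"
  by (simp add: mat_def vec_eq_iff)

lemma matrix_add_rdistrib: "(A + B) ** C = A ** C + B ** (C :: 'a::semiring_1 ^ 'n ^ 'm)"
  by (simp add: matrix_matrix_mult_def vec_eq_iff distrib_right sum.distrib)

lemma mat_vec_mult: "mat a *v h = a *s (h :: 'a::comm_semiring_1 ^ 'n)"
  by (simp add: matrix_vector_mult_def mat_def vec_eq_iff if_distrib[of "\<lambda>x. x * _"] cong: if_cong)

lemma matrix_inv_eqI:
  fixes A B :: "'a::field ^ 'n ^ 'n"
  assumes "A ** B = mat 1"
  shows "matrix_inv A = B"
proof -
  have BA: "B ** A = mat 1" using assms matrix_left_right_inverse by blast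
  then have inv: "A ** matrix_inv A = mat 1 \<and> matrix_inv A ** A = mat 1"
    unfolding matrix_inv_def using assms by (intro someI[of "\<lambda>A'. A ** A' = mat 1 \<and> A' ** A = mat 1" B]) simp
  have "matrix_inv A = B ** A ** matrix_inv A" by (simp add: BA)
  also have "\<dots> = B ** (A ** matrix_inv A)" by (rule matrix_mul_assoc[symmetric])
  also have "\<dots> = B" using inv by simp
  finally show ?thesis .
qed

text \<open>
  For \<open>N\<^sup>2 = 0\<close> these are the values \<open>f(T)\<close> at \<open>T = \<mu> + N\<close>, where \<open>\<alpha> = f(\<mu>)\<close> and
  \<open>\<beta> = f'(\<mu>)\<close>: the matrices multiply like first-order Taylor polynomials.
\<close>

definition jet :: "complex ^ 'n ^ 'n \<Rightarrow> complex \<Rightarrow> complex \<Rightarrow> complex ^ 'n ^ 'n" where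
  "jet N \<alpha> \<beta> = mat \<alpha> + mat \<beta> ** N"

lemma jet_add: "jet N \<alpha> \<beta> + jet N \<alpha>' \<beta>' = jet N (\<alpha> + \<alpha>') (\<beta> + \<beta>')"
  by (simp add: jet_def mat_add matrix_add_rdistrib)

lemma jet_mult:
  assumes "N ** N = 0"
  shows "jet N \<alpha> \<beta> ** jet N \<alpha>' \<beta>' = jet N (\<alpha> * \<alpha>') (\<alpha> * \<beta>' + \<beta> * \<alpha>')"
proof -
  have "mat \<beta> ** N ** (mat \<beta>' ** N) = mat \<beta> ** (N ** mat \<beta>') ** N"
    by (simp only: matrix_mul_assoc)
  also have "\<dots> = mat \<beta> ** mat \<beta>' ** (N ** N)"
    unfolding mat_mul_commute[of N] by (simp only: matrix_mul_assoc)
  finally have 1: "mat \<beta> ** N ** (mat \<beta>' ** N) = 0" by (simp add: assms)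
  have "mat \<beta> ** N ** mat \<alpha>' = mat \<beta> ** (N ** mat \<alpha>')"
    by (simp only: matrix_mul_assoc)
  also have "\<dots> = mat (\<beta> * \<alpha>') ** N"
    unfolding mat_mul_commute[of N] by (simp only: matrix_mul_assoc mat_mul_mat)
  finally have 2: "mat \<beta> ** N ** mat \<alpha>' = mat (\<beta> * \<alpha>') ** N" .
  have 3: "mat \<alpha> ** (mat \<beta>' ** N) = mat (\<alpha> * \<beta>') ** N"
    by (simp only: matrix_mul_assoc mat_mul_mat)
  show ?thesis
    by (simp add: jet_def matrix_add_ldistrib matrix_add_rdistrib mat_mul_mat mat_add 1 2 3)
qed

lemma jet_one: "jet N 1 0 = mat 1"
  by (simp add: jet_def)

lemma jet_scalar: "mat a ** jet N \<alpha> \<beta> = jet N (a * \<alpha>) (a * \<beta>)"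
  by (simp add: jet_def matrix_add_ldistrib mat_mul_mat matrix_mul_assoc)

lemma jet_inverse:
  assumes "N ** N = 0" "\<alpha> \<noteq> 0"
  shows "matrix_inv (jet N \<alpha> \<beta>) = jet N (1 / \<alpha>) (- \<beta> / \<alpha>\<^sup>2)"
proof (rule matrix_inv_eqI)
  have eq: "\<alpha> * (- \<beta> / \<alpha>\<^sup>2) + \<beta> * (1 / \<alpha>) = 0"
    using assms by (simp add: field_simps power2_eq_square)
  show "jet N \<alpha> \<beta> ** jet N (1 / \<alpha>) (- \<beta> / \<alpha>\<^sup>2) = mat 1"
    unfolding jet_mult[OF assms(1)] eq using assms(2) by (simp add: jet_one)
qed

lemma jet_power:
  assumes "N ** N = 0"
  shows "(((**) (jet N \<mu> 1)) ^^ i) (mat 1) = jet N (\<mu> ^ i) (of_nat i * \<mu> ^ (i - 1))"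
proof (induction i)
  case (Suc i)
  have eq: "\<mu> * (of_nat i * \<mu> ^ (i - 1)) + 1 * \<mu> ^ i = of_nat (Suc i) * \<mu> ^ (Suc i - 1)"
    by (cases i) (simp_all add: algebra_simps)
  have "(((**) (jet N \<mu> 1)) ^^ Suc i) (mat 1) = jet N \<mu> 1 ** jet N (\<mu> ^ i) (of_nat i * \<mu> ^ (i - 1))"
    by (simp add: Suc.IH)
  also have "\<dots> = jet N (\<mu> ^ Suc i) (of_nat (Suc i) * \<mu> ^ (Suc i - 1))"
    unfolding jet_mult[OF assms] by (simp only: eq power_Suc)
  finally show ?case .
qed (simp add: jet_one)

text \<open>
  The coefficient of \<open>N\<close> is the term-by-term derivative of the coefficient sum; uniqueness of
  derivatives identifies it with \<open>pderiv\<close>.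
\<close>

lemma poly_mat_jet:
  assumes "N ** N = 0"
  shows "poly_mat p (jet N \<mu> 1) = jet N (poly p \<mu>) (poly (pderiv p) \<mu>)"
proof -
  have "((\<lambda>x. \<Sum>i\<le>degree p. coeff p i * x ^ i) has_field_derivative
          (\<Sum>i\<le>degree p. coeff p i * (of_nat i * \<mu> ^ (i - 1)))) (at \<mu>)"
    by (auto intro!: derivative_eq_intros simp: mult_ac)
  then have "(poly p has_field_derivative (\<Sum>i\<le>degree p. coeff p i * (of_nat i * \<mu> ^ (i - 1)))) (at \<mu>)"
    by (simp add: poly_altdef[abs_def])
  then have d: "(\<Sum>i\<le>degree p. coeff p i * (of_nat i * \<mu> ^ (i - 1))) = poly (pderiv p) \<mu>"
    using poly_DERIV DERIV_unique by blast
  have sum: "(\<Sum>i\<in>S. jet N (\<alpha> i) (\<beta> i)) = jet N (sum \<alpha> S) (sum \<beta> S)" if "finite S" for S :: "nat set" and \<alpha> \<beta>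
    using that by (induction S) (simp_all add: jet_add, simp add: jet_def)
  show ?thesis
    unfolding poly_mat_def jet_power[OF assms] jet_scalar
    by (simp only: sum finite_atMost d) (simp add: poly_altdef)
qed

lemma rational_mat_jet:
  assumes "N ** N = 0" "poly q \<mu> \<noteq> 0"
  shows "poly_mat p (jet N \<mu> 1) ** matrix_inv (poly_mat q (jet N \<mu> 1))
       = jet N (poly p \<mu> / poly q \<mu>) (deriv (\<lambda>z. poly p z / poly q z) \<mu>)"
proof -
  have "((\<lambda>z. poly p z / poly q z) has_field_derivative
      (poly (pderiv p) \<mu> * poly q \<mu> - poly p \<mu> * poly (pderiv q) \<mu>) / (poly q \<mu> * poly q \<mu>)) (at \<mu>)"
    using assms by (auto intro!: DERIV_divide poly_DERIV)
  then have "deriv (\<lambda>z. poly p z / poly q z) \<mu>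
      = (poly (pderiv p) \<mu> * poly q \<mu> - poly p \<mu> * poly (pderiv q) \<mu>) / (poly q \<mu> * poly q \<mu>)"
    by (rule DERIV_imp_deriv)
  also have "\<dots> = poly p \<mu> * (- poly (pderiv q) \<mu> / (poly q \<mu>)\<^sup>2) + poly (pderiv p) \<mu> * (1 / poly q \<mu>)"
    using assms by (simp add: field_simps power2_eq_square)
  finally show ?thesis
    using assms by (simp add: poly_mat_jet jet_inverse jet_mult)
qed

section \<open>Nilpotent two-by-two matrices\<close>

text \<open>
  The rank-one matrix that sends \<open>h\<close> to \<open>(P h\<^sub>2 - Q h\<^sub>1) (P, Q)\<close>. All nilpotent
  two-by-two matrices have this form, and the operator norm is \<open>|P|\<^sup>2 + |Q|\<^sup>2\<close>. The two
  parameters replace a unitary triangularisation: \<open>(P, Q)\<close> spans the range, and \<open>(- cnj Q, cnj P)\<close>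
  is orthogonal to it and has the same length.
\<close>

definition nilpotent2 :: "complex \<Rightarrow> complex \<Rightarrow> complex ^ 2 ^ 2" where
  "nilpotent2 P Q = vector [vector [- P * Q, P\<^sup>2], vector [- Q\<^sup>2, P * Q]]"

lemma nilpotent2_nth:
  "nilpotent2 P Q $ 1 $ 1 = - (P * Q)" "nilpotent2 P Q $ 1 $ 2 = P * P"
  "nilpotent2 P Q $ 2 $ 1 = - (Q * Q)" "nilpotent2 P Q $ 2 $ 2 = P * Q"
  by (simp_all add: nilpotent2_def power2_eq_square)

lemma nilpotent2_square: "nilpotent2 P Q ** nilpotent2 P Q = 0"
  unfolding matrix_matrix_mult_def vec_eq_iff forall_2
  by (simp add: nilpotent2_nth sum_2)

lemma nilpotent2_vec: "nilpotent2 P Q *v h = (P * h $ 2 - Q * h $ 1) *s vector [P, Q]"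
  unfolding matrix_vector_mult_def vec_eq_iff forall_2
  by (simp add: nilpotent2_nth sum_2 algebra_simps)

text \<open>
  The off-diagonal entries determine \<open>P\<^sup>2\<close> and \<open>Q\<^sup>2\<close>; the diagonal entry \<open>- P Q\<close>, whose square
  is prescribed by the determinant, settles the relative sign of the two roots.
\<close>

lemma nilpotent2_exhaust:
  fixes N :: "complex ^ 2 ^ 2"
  assumes "N $ 1 $ 1 + N $ 2 $ 2 = 0" "det N = 0"
  obtains P Q where "N = nilpotent2 P Q"
proof (cases "N $ 1 $ 2 = 0")
  case True
  then have "N $ 1 $ 1 = 0" "N $ 2 $ 2 = 0"
    using assms by (auto simp: det_2 add_eq_0_iff)
  moreover have "csqrt (- N $ 2 $ 1) * csqrt (- N $ 2 $ 1) = - N $ 2 $ 1"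
    by (metis power2_csqrt power2_eq_square)
  ultimately have "N = nilpotent2 0 (csqrt (- N $ 2 $ 1))"
    using True by (simp add: nilpotent2_nth vec_eq_iff forall_2)
  then show ?thesis by (rule that)
next
  case False
  define P where "P = csqrt (N $ 1 $ 2)"
  have P: "P \<noteq> 0" "N $ 1 $ 2 = P * P"
    using False by (auto simp: P_def power2_eq_square[symmetric])
  have tr: "N $ 2 $ 2 = - N $ 1 $ 1" using assms(1) by (metis add.commute eq_neg_iff_add_eq_0)
  have "N $ 1 $ 2 * N $ 2 $ 1 = N $ 1 $ 1 * N $ 2 $ 2" using assms(2) by (simp add: det_2)
  then have "P * P * N $ 2 $ 1 = - (N $ 1 $ 1 * N $ 1 $ 1)" by (simp add: tr P)
  then have "N $ 2 $ 1 = - (N $ 1 $ 1 * N $ 1 $ 1) / (P * P)"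
    using P by (metis nonzero_mult_div_cancel_left no_zero_divisors)
  then have "N = nilpotent2 P (- N $ 1 $ 1 / P)"
    using P tr by (simp add: nilpotent2_nth vec_eq_iff forall_2)
  then show ?thesis by (rule that)
qed

lemma norm_vec_2_square: "(norm (h :: complex ^ 2))\<^sup>2 = (norm (h $ 1))\<^sup>2 + (norm (h $ 2))\<^sup>2"
  by (simp add: norm_vec_def L2_set_def sum_2)

text \<open>
  If \<open>\<mu>\<close> is an eigenvalue, then so is the trace minus \<open>\<mu>\<close>; with only one eigenvalue the trace
  is \<open>2 \<mu>\<close>, so \<open>T - \<mu>\<close> has trace and determinant zero.
\<close>

lemma single_eigenvalue_jet:
  fixes T :: "complex ^ 2 ^ 2"
  assumes "\<exists>!\<mu>. is_eigenvalue T \<mu>"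
  obtains \<mu> P Q where "T = jet (nilpotent2 P Q) \<mu> 1" "\<mu> \<in> spectrum T"
proof -
  have inv: "is_eigenvalue T \<nu> \<longleftrightarrow> \<not> invertible (T - mat \<nu>)" for \<nu>
  proof -
    have "(T - mat \<nu>) *v v = 0 \<longleftrightarrow> T *v v = \<nu> *s v" for v
      by (simp add: matrix_vector_mult_diff_rdistrib mat_vec_mult)
    then show ?thesis
      unfolding is_eigenvalue_def invertible_left_inverse matrix_left_invertible_ker by blast
  qed
  have ev: "is_eigenvalue T \<nu> \<longleftrightarrow> det (T - mat \<nu>) = 0" for \<nu>
    by (simp add: inv invertible_det_nz)
  obtain \<mu> where \<mu>: "is_eigenvalue T \<mu>" and uniq: "\<And>\<nu>. is_eigenvalue T \<nu> \<Longrightarrow> \<nu> = \<mu>"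
    using assms by blast
  define N where "N = T - mat \<mu>"
  have "det (T - mat (T $ 1 $ 1 + T $ 2 $ 2 - \<mu>)) = det (T - mat \<mu>)"
    by (simp add: det_2 mat_def algebra_simps)
  then have "T $ 1 $ 1 + T $ 2 $ 2 - \<mu> = \<mu>" using \<mu> uniq ev by metis
  then have "N $ 1 $ 1 + N $ 2 $ 2 = 0" by (simp add: N_def mat_def)
  moreover have "det N = 0" using \<mu> ev by (simp add: N_def)
  ultimately obtain P Q where "N = nilpotent2 P Q" by (rule nilpotent2_exhaust)
  moreover have "T = mat \<mu> + N" by (simp add: N_def)
  ultimately have "T = jet (nilpotent2 P Q) \<mu> 1" by (simp add: jet_def)
  moreover have "\<mu> \<in> spectrum T" using \<mu> inv unfolding spectrum_def by blast
  ultimately show ?thesis by (rule that)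
qed

text \<open>
  The norm estimate for a triangular matrix with diagonal \<open>a, a\<close> and corner \<open>g\<close>. The
  difference of the two sides is a quadratic form in \<open>x, y\<close> with leading coefficient
  \<open>e = K\<^sup>2 - a\<^sup>2 > 0\<close>, and it is positive semidefinite because \<open>K g \<le> e\<close>.
\<close>

lemma quadratic_form_bound:
  fixes a g K x y :: real
  assumes "0 \<le> a" "a \<le> 1" "1 < K" "0 \<le> g" "g \<le> K * (1 - a\<^sup>2)"
  shows "(a * x + g * y)\<^sup>2 + (a * y)\<^sup>2 \<le> K\<^sup>2 * (x\<^sup>2 + y\<^sup>2)"
proof -
  define e where "e = K\<^sup>2 - a\<^sup>2"
  have a2: "a\<^sup>2 \<le> 1" using assms by (simp add: power_le_one)
  have K2: "1 < K\<^sup>2" using assms by (simp add: one_less_power)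
  have e: "0 < e" using a2 K2 by (simp add: e_def)
  have "K * g \<le> K * (K * (1 - a\<^sup>2))" using assms by (intro mult_left_mono) auto
  also have "\<dots> = K\<^sup>2 - K\<^sup>2 * a\<^sup>2" by (simp add: power2_eq_square algebra_simps)
  also have "\<dots> \<le> e" using mult_right_mono[of 1 "K\<^sup>2" "a\<^sup>2"] K2 by (simp add: e_def)
  finally have "(K * g)\<^sup>2 \<le> e\<^sup>2" using assms by (intro power_mono) auto
  then have "0 \<le> (e * x - a * g * y)\<^sup>2 + (e\<^sup>2 - (K * g)\<^sup>2) * y\<^sup>2" by simp
  also have "\<dots> = e * (K\<^sup>2 * (x\<^sup>2 + y\<^sup>2) - ((a * x + g * y)\<^sup>2 + (a * y)\<^sup>2))"
    unfolding e_def by (simp add: power2_eq_square algebra_simps)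
  finally show ?thesis using e by (simp add: zero_le_mult_iff)
qed

text \<open>
  The numbers \<open>x\<close> and \<open>y\<close> are \<open>sqrt a\<close> times the coordinates of \<open>h\<close> in the orthonormal
  basis obtained by normalising \<open>(P, Q)\<close> and \<open>(- cnj Q, cnj P)\<close>. In that basis the matrix is
  upper triangular with diagonal entries \<open>\<alpha>\<close> and corner \<open>a \<beta>\<close>.
\<close>

lemma nilpotent2_frame:
  fixes P Q :: complex and h :: "complex ^ 2"
  defines "x \<equiv> cnj P * h $ 1 + cnj Q * h $ 2" and "y \<equiv> P * h $ 2 - Q * h $ 1"
    and "a \<equiv> (norm P)\<^sup>2 + (norm Q)\<^sup>2"
  shows "(norm x)\<^sup>2 + (norm y)\<^sup>2 = a * (norm h)\<^sup>2"
    and "a * (norm (jet (nilpotent2 P Q) \<alpha> \<beta> *v h))\<^sup>2 = (norm (\<alpha> * x + a * \<beta> * y))\<^sup>2 + (norm (\<alpha> * y))\<^sup>2"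
proof -
  have fr: "(norm (cnj P * u + cnj Q * v))\<^sup>2 + (norm (P * v - Q * u))\<^sup>2
      = ((norm P)\<^sup>2 + (norm Q)\<^sup>2) * ((norm u)\<^sup>2 + (norm v)\<^sup>2)" for u v
  proof -
    have "complex_of_real ((norm (cnj P * u + cnj Q * v))\<^sup>2 + (norm (P * v - Q * u))\<^sup>2)
      = of_real (((norm P)\<^sup>2 + (norm Q)\<^sup>2) * ((norm u)\<^sup>2 + (norm v)\<^sup>2))"
      unfolding of_real_add of_real_mult complex_norm_square by (simp add: algebra_simps)
    then show ?thesis by (simp only: of_real_eq_iff)
  qed
  show "(norm x)\<^sup>2 + (norm y)\<^sup>2 = a * (norm h)\<^sup>2"
    unfolding x_def y_def a_def norm_vec_2_square by (rule fr)
  define k where "k = jet (nilpotent2 P Q) \<alpha> \<beta> *v h"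
  have k: "k $ 1 = \<alpha> * h $ 1 + \<beta> * y * P" "k $ 2 = \<alpha> * h $ 2 + \<beta> * y * Q"
    by (simp_all add: k_def jet_def matrix_vector_mult_add_rdistrib mat_vec_mult nilpotent2_vec
        y_def[symmetric] matrix_vector_mul_assoc[symmetric])
  have "cnj P * k $ 1 + cnj Q * k $ 2 = \<alpha> * x + (P * cnj P + Q * cnj Q) * \<beta> * y"
    unfolding k x_def by (simp add: algebra_simps)
  also have "P * cnj P + Q * cnj Q = a" unfolding a_def of_real_add complex_norm_square ..
  finally have 1: "cnj P * k $ 1 + cnj Q * k $ 2 = \<alpha> * x + a * \<beta> * y" .
  have 2: "P * k $ 2 - Q * k $ 1 = \<alpha> * y"
    unfolding k y_def by (simp add: algebra_simps)
  show "a * (norm (jet (nilpotent2 P Q) \<alpha> \<beta> *v h))\<^sup>2 = (norm (\<alpha> * x + a * \<beta> * y))\<^sup>2 + (norm (\<alpha> * y))\<^sup>2"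
    using fr[of "k $ 1" "k $ 2"] unfolding 1 2 k_def[symmetric] norm_vec_2_square a_def by simp
qed

text \<open>
  In the adapted orthonormal basis the matrix is triangular, so this is the estimate of
  \<open>quadratic_form_bound\<close>. The factor \<open>1 - |\<alpha>|\<^sup>2\<close> in the hypothesis is the one that the
  Schwarz-Pick estimate supplies.
\<close>

lemma jet_norm_bound:
  assumes \<alpha>: "norm \<alpha> \<le> 1" and K: "1 < K"
    and \<beta>: "((norm P)\<^sup>2 + (norm Q)\<^sup>2) * norm \<beta> \<le> K * (1 - (norm \<alpha>)\<^sup>2)"
  shows "norm (jet (nilpotent2 P Q) \<alpha> \<beta> *v h) \<le> K * norm h"
proof (cases "P = 0 \<and> Q = 0")
  case True
  then have "nilpotent2 P Q = 0" by (simp add: nilpotent2_nth vec_eq_iff forall_2)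
  then have "norm (jet (nilpotent2 P Q) \<alpha> \<beta> *v h) = norm \<alpha> * norm h"
    by (simp add: jet_def mat_vec_mult norm_vec_def L2_set_def norm_mult sum_2 power_mult_distrib
         distrib_left[symmetric] real_sqrt_mult)
  also have "\<dots> \<le> K * norm h" using \<alpha> K by (intro mult_right_mono) auto
  finally show ?thesis .
next
  case False
  define a where "a = (norm P)\<^sup>2 + (norm Q)\<^sup>2"
  have a: "0 < a" using False by (auto simp: a_def add_nonneg_pos add_pos_nonneg)
  define x where "x = cnj P * h $ 1 + cnj Q * h $ 2"
  define y where "y = P * h $ 2 - Q * h $ 1"
  have "norm (\<alpha> * x + a * \<beta> * y) \<le> norm \<alpha> * norm x + (a * norm \<beta>) * norm y"
    using norm_triangle_ineq[of "\<alpha> * x" "a * \<beta> * y"] a by (simp add: norm_mult)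
  then have "(norm (\<alpha> * x + a * \<beta> * y))\<^sup>2 \<le> (norm \<alpha> * norm x + (a * norm \<beta>) * norm y)\<^sup>2"
    by (intro power_mono) auto
  then have "a * (norm (jet (nilpotent2 P Q) \<alpha> \<beta> *v h))\<^sup>2
      \<le> (norm \<alpha> * norm x + (a * norm \<beta>) * norm y)\<^sup>2 + (norm \<alpha> * norm y)\<^sup>2"
    unfolding nilpotent2_frame(2)[of P Q, folded a_def x_def y_def]
    by (simp only: x_def[symmetric] y_def[symmetric] norm_mult)
  also have "\<dots> \<le> K\<^sup>2 * ((norm x)\<^sup>2 + (norm y)\<^sup>2)"
    by (rule quadratic_form_bound) (use \<alpha> K \<beta> a in \<open>auto simp: a_def[symmetric]\<close>)
  also have "\<dots> = a * (K * norm h)\<^sup>2"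
    unfolding nilpotent2_frame(1)[of P h Q, folded a_def x_def y_def] by (simp add: power_mult_distrib)
  finally have "(norm (jet (nilpotent2 P Q) \<alpha> \<beta> *v h))\<^sup>2 \<le> (K * norm h)\<^sup>2" using a by simp
  then show ?thesis using K by (simp add: power2_le_iff_abs_le)
qed

section \<open>The positivity condition for a Jordan block\<close>

lemma cinner_add_left: "cinner (x + y) z = cinner x z + cinner y z"
  by (simp add: cinner_def distrib_right sum.distrib)

lemma cinner_scale_left: "cinner (a *s x) z = a * cinner x z"
  by (simp add: cinner_def sum_distrib_left mult.assoc)

lemma cinner_commute: "cinner x y = cnj (cinner y x)"
  by (simp add: cinner_def mult.commute)

lemma double_re_part: "2 *\<^sub>R re_part X = X + cadjoint X"
  by (simp add: re_part_def)

lemma Re_cinner_double_re_part: "Re (cinner ((2 *\<^sub>R re_part X) *v h) h) = 2 * Re (cinner (X *v h) h)"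
proof -
  have "cinner (X *v h) h = cnj (cinner (cadjoint X *v h) h)"
    by (metis cinner_cadjoint cinner_commute)
  then show ?thesis
    by (simp add: double_re_part matrix_vector_mult_add_rdistrib cinner_add_left)
qed

text \<open>
  In the adapted orthonormal basis the operator is Hermitian with equal diagonal entries
  \<open>d = 2 Re \<alpha> - 2 + c\<close> and corner \<open>a \<beta>\<close>, so positivity means \<open>a |\<beta>| \<le> d\<close>. The vector
  \<open>h\<close> is \<open>(P, Q) - \<epsilon> (- cnj Q, cnj P)\<close>, which tests the corner in the direction of the
  phase \<open>\<epsilon>\<close>.
\<close>

lemma positive_jet:
  assumes pos: "positive_op (2 *\<^sub>R re_part (jet (nilpotent2 P Q) \<alpha> \<beta>) - mat 2 + mat (of_real c))"
    and e: "norm \<epsilon> = 1" and ne: "P \<noteq> 0 \<or> Q \<noteq> 0"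
  shows "((norm P)\<^sup>2 + (norm Q)\<^sup>2) * Re (\<beta> * \<epsilon>) \<le> 2 * Re \<alpha> - 2 + c"
proof -
  define a where "a = (norm P)\<^sup>2 + (norm Q)\<^sup>2"
  have a: "0 < a" using ne by (auto simp: a_def add_nonneg_pos add_pos_nonneg)
  have aa: "P * cnj P + Q * cnj Q = of_real a" unfolding a_def of_real_add complex_norm_square ..
  have ee: "\<epsilon> * cnj \<epsilon> = 1" using e by (metis complex_norm_square of_real_1 power_one)
  define h :: "complex ^ 2" where "h = vector [P + \<epsilon> * cnj Q, Q - \<epsilon> * cnj P]"
  have hh: "cinner h h = of_real (2 * a)"
    using ee by (simp add: cinner_def sum_2 h_def aa[symmetric] algebra_simps) algebra
  have "P * h $ 2 - Q * h $ 1 = - \<epsilon> * of_real a"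
    by (simp add: h_def aa[symmetric] algebra_simps)
  moreover have "cinner (vector [P, Q]) h = of_real a"
    by (simp add: cinner_def sum_2 h_def aa[symmetric] algebra_simps)
  ultimately have Nh: "cinner (nilpotent2 P Q *v h) h = - \<epsilon> * of_real (a * a)"
    unfolding nilpotent2_vec cinner_scale_left by simp
  have "0 \<le> Re (cinner ((2 *\<^sub>R re_part (jet (nilpotent2 P Q) \<alpha> \<beta>) - mat 2 + mat (of_real c)) *v h) h)"
    using pos by (auto simp: positive_op_def complex_nonneg_Reals_iff)
  also have "2 *\<^sub>R re_part (jet (nilpotent2 P Q) \<alpha> \<beta>) - mat 2 + mat (of_real c)
      = 2 *\<^sub>R re_part (jet (nilpotent2 P Q) \<alpha> \<beta>) + mat (of_real (c - 2))"
    by (simp add: mat_def vec_eq_iff)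
  also have "Re (cinner (\<dots> *v h) h) = 2 * Re (cinner (jet (nilpotent2 P Q) \<alpha> \<beta> *v h) h) + (c - 2) * (2 * a)"
    by (simp add: matrix_vector_mult_add_rdistrib cinner_add_left Re_cinner_double_re_part
        mat_vec_mult cinner_scale_left hh del: of_real_diff)
  also have "cinner (jet (nilpotent2 P Q) \<alpha> \<beta> *v h) h = \<alpha> * of_real (2 * a) - \<beta> * \<epsilon> * of_real (a * a)"
    by (simp add: jet_def matrix_vector_mult_add_rdistrib cinner_add_left mat_vec_mult
        cinner_scale_left hh Nh matrix_vector_mul_assoc[symmetric])
  also have "2 * Re \<dots> + (c - 2) * (2 * a) = (2 * a) * (2 * Re \<alpha> - 2 + c - a * Re (\<beta> * \<epsilon>))"
    by (simp add: algebra_simps)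
  finally show ?thesis using a by (simp add: zero_le_mult_iff a_def)
qed

text \<open>
  The two inverses are the values at \<open>T\<close> of \<open>u \<mapsto> 1 / (1 - z u / R)\<close> and \<open>u \<mapsto> 1 / (1 - w / (R u))\<close>.
  Their derivatives at \<open>\<mu>\<close> are written as Koebe functions \<open>v / (1 - v)\<^sup>2\<close> of \<open>z \<mu> / R\<close> and of
  \<open>w / (R \<mu>)\<close>, with a common factor \<open>1 / \<mu>\<close>.
\<close>

lemma double_layer_jet:
  assumes N: "N ** N = 0" and R: "R \<noteq> 0" and \<mu>: "\<mu> \<noteq> 0"
    and z: "1 - z * \<mu> / of_real R \<noteq> 0" and w: "1 - w / (of_real R * \<mu>) \<noteq> 0"
  shows "matrix_inv (mat 1 - mat (z / of_real R) ** jet N \<mu> 1)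
       + matrix_inv (mat 1 - mat (w / of_real R) ** matrix_inv (jet N \<mu> 1))
     = jet N (1 / (1 - z * \<mu> / of_real R) + 1 / (1 - w / (of_real R * \<mu>)))
         (((z * \<mu> / of_real R) / (1 - z * \<mu> / of_real R)\<^sup>2
           - (w / (of_real R * \<mu>)) / (1 - w / (of_real R * \<mu>))\<^sup>2) / \<mu>)"
proof -
  have m: "mat 1 - mat k ** jet N \<alpha> \<beta> = jet N (1 - k * \<alpha>) (- k * \<beta>)" for k \<alpha> \<beta>
    by (simp add: jet_def matrix_add_ldistrib mat_mul_mat matrix_mul_assoc)
       (simp add: mat_def vec_eq_iff matrix_matrix_mult_def if_distrib[of "\<lambda>x. x * _"] cong: if_cong)
  have 1: "matrix_inv (mat 1 - mat (z / of_real R) ** jet N \<mu> 1)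
      = jet N (1 / (1 - z * \<mu> / of_real R)) ((z / of_real R) / (1 - z * \<mu> / of_real R)\<^sup>2)"
    unfolding m by (subst jet_inverse) (use N z in auto)
  have 2: "matrix_inv (mat 1 - mat (w / of_real R) ** matrix_inv (jet N \<mu> 1))
      = jet N (1 / (1 - w / (of_real R * \<mu>))) (- (w / (of_real R * \<mu>\<^sup>2)) / (1 - w / (of_real R * \<mu>))\<^sup>2)"
    unfolding jet_inverse[OF N \<mu>] m by (subst jet_inverse) (use N w in auto)
  have 3: "(z / of_real R) / Z + - (w / (of_real R * \<mu>\<^sup>2)) / W
     = ((z * \<mu> / of_real R) / Z - (w / (of_real R * \<mu>)) / W) / \<mu>" for Z W
    using \<mu> R by (simp add: power2_eq_square diff_divide_distrib)
  show ?thesis unfolding 1 2 jet_add 3 ..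
qed

text \<open>
  Clearing of denominators, where both sides of the hypothesis produce the same factor:
  \<open>x (1 + y)\<^sup>2 + y (1 - x)\<^sup>2 = (x + y) (1 + x y)\<close> and
  \<open>(1 - x) + (1 + y) - (1 - x) (1 + y) = 1 + x y\<close>.
\<close>

lemma two_poles_inequality:
  fixes x y A c :: real
  assumes "x < 1" "- 1 < y"
    and "A * (x / (1 - x)\<^sup>2 + y / (1 + y)\<^sup>2) \<le> 2 / (1 - x) + 2 / (1 + y) - 2 + c"
  shows "A * (x + y) * (1 + x * y) \<le> 2 * (1 + x * y) * ((1 - x) * (1 + y)) + c * ((1 - x) * (1 + y))\<^sup>2"
proof -
  define X where "X = 1 - x"
  define Y where "Y = 1 + y"
  have XY: "X > 0" "Y > 0" using assms by (auto simp: X_def Y_def)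
  have x: "x = 1 - X" "y = Y - 1" by (auto simp: X_def Y_def)
  have "x * Y\<^sup>2 + y * X\<^sup>2 = (x + y) * (1 + x * y)"
    unfolding x by (simp add: algebra_simps power2_eq_square)
  then have "A * (x + y) * (1 + x * y) = A * (x * Y\<^sup>2 + y * X\<^sup>2)" by simp
  also have "\<dots> = A * (x / X\<^sup>2 + y / Y\<^sup>2) * (X * Y)\<^sup>2"
    using XY by (simp add: field_simps)
  also have "\<dots> \<le> (2 / X + 2 / Y - 2 + c) * (X * Y)\<^sup>2"
    using assms by (intro mult_right_mono) (auto simp: X_def Y_def)
  also have "\<dots> = 2 * (X + Y - X * Y) * (X * Y) + c * (X * Y)\<^sup>2"
    using XY by (simp add: field_simps power2_eq_square)
  also have "X + Y - X * Y = 1 + x * y"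
    unfolding x by (simp add: algebra_simps)
  finally show ?thesis by (simp only: X_def Y_def)
qed

text \<open>
  The positivity condition is tested at the points \<open>z, w\<close> of modulus \<open>t\<close> that make \<open>z \<mu>\<close> and
  \<open>w / \<mu>\<close> real of opposite signs. The two terms of the derivative enter with opposite signs, so here they
  add up. The sign \<open>e\<close> selects one of the two possible choices.
\<close>

lemma DLA_jet_inequality:
  fixes R c e t :: real and \<mu> P Q :: complex
  defines "s \<equiv> norm \<mu> / R" and "r \<equiv> 1 / (R * norm \<mu>)" and "a \<equiv> (norm P)\<^sup>2 + (norm Q)\<^sup>2"
  assumes R: "R > 1" and \<mu>: "1 / R \<le> norm \<mu>" "norm \<mu> \<le> R"
    and T: "jet (nilpotent2 P Q) \<mu> 1 \<in> DLA R c" and ne: "P \<noteq> 0 \<or> Q \<noteq> 0"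
    and e: "e = 1 \<or> e = - 1" and t: "0 < t" "t < 1"
  shows "a / norm \<mu> * (t * s / (1 - e * t * s)\<^sup>2 + t * r / (1 + e * t * r)\<^sup>2)
      \<le> 2 / (1 - e * t * s) + 2 / (1 + e * t * r) - 2 + c"
proof -
  define m where "m = norm \<mu>"
  have m: "0 < m" using \<mu> R by (auto simp: m_def intro: less_le_trans[of 0 "1 / R"])
  have \<mu>0: "\<mu> \<noteq> 0" using m by (auto simp: m_def)
  have sr: "0 < s" "s \<le> 1" "0 < r" "r \<le> 1"
    using R m \<mu> by (auto simp: s_def r_def m_def field_simps)
  have small: "t * s < 1" "t * r < 1"
    using sr t by (smt (verit) mult_left_le)+
  have ee: "e * e = 1" using e by auto
  have pos: "0 < 1 - e * t * s" "0 < 1 + e * t * r"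
    using e small mult_pos_pos[OF t(1) sr(1)] mult_pos_pos[OF t(1) sr(3)] by auto
  define z where "z = of_real (e * t / m) * cnj \<mu>"
  define w where "w = of_real (- e * t / m) * \<mu>"
  have "norm z < 1" "norm w < 1"
    using e t m by (auto simp: z_def w_def norm_mult norm_divide m_def[symmetric])
  then have "z \<in> ball 0 1" "w \<in> ball 0 1" by auto
  then have P: "positive_op (2 *\<^sub>R re_part (matrix_inv (mat 1 - mat (z / of_real R) ** jet (nilpotent2 P Q) \<mu> 1)
         + matrix_inv (mat 1 - mat (w / of_real R) ** matrix_inv (jet (nilpotent2 P Q) \<mu> 1)))
           - mat 2 + mat (of_real c))"
    using T unfolding DLA_def by blast
  have z: "z * \<mu> / of_real R = of_real (e * t * s)"
  proof -
    have "cnj \<mu> * \<mu> = of_real (m * m)"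
      unfolding m_def by (metis complex_norm_square mult.commute power2_eq_square)
    then have "z * \<mu> / of_real R = of_real (e * t / m) * of_real (m * m) / of_real R"
      by (simp only: z_def mult.assoc)
    also have "\<dots> = of_real (e * t * s)" using m by (simp add: s_def m_def[symmetric])
    finally show ?thesis .
  qed
  have w: "w / (of_real R * \<mu>) = of_real (- e * t * r)"
    using \<mu>0 m by (simp add: w_def r_def m_def[symmetric])
  define \<alpha> where "\<alpha> = 1 / (1 - e * t * s) + 1 / (1 + e * t * r)"
  define k where "k = t * s / (1 - e * t * s)\<^sup>2 + t * r / (1 + e * t * r)\<^sup>2"
  have J: "matrix_inv (mat 1 - mat (z / of_real R) ** jet (nilpotent2 P Q) \<mu> 1)
         + matrix_inv (mat 1 - mat (w / of_real R) ** matrix_inv (jet (nilpotent2 P Q) \<mu> 1))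
       = jet (nilpotent2 P Q) (of_real \<alpha>) (of_real (e * k) / \<mu>)"
  proof -
    have nz': "1 - complex_of_real v \<noteq> 0" if "1 - v \<noteq> 0" for v
      using that by (metis of_real_1 of_real_diff of_real_eq_0_iff)
    have nz: "1 - z * \<mu> / of_real R \<noteq> 0" "1 - w / (of_real R * \<mu>) \<noteq> 0"
      unfolding z w by (rule nz', use pos in simp)+
    have R0: "R \<noteq> 0" using R by simp
    have 1: "1 / (1 - complex_of_real (e * t * s)) + 1 / (1 - complex_of_real (- e * t * r)) = of_real \<alpha>"
      by (simp add: \<alpha>_def)
    have ek: "e * k = (e * t * s) / (1 - e * t * s)\<^sup>2 - (- e * t * r) / (1 - (- e * t * r))\<^sup>2"
      by (simp add: k_def distrib_left mult.assoc)
    have 2: "complex_of_real (e * t * s) / (1 - complex_of_real (e * t * s))\<^sup>2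
        - complex_of_real (- e * t * r) / (1 - complex_of_real (- e * t * r))\<^sup>2 = of_real (e * k)"
      by (simp only: ek of_real_diff of_real_divide of_real_power of_real_1)
    show ?thesis
      unfolding double_layer_jet[OF nilpotent2_square R0 \<mu>0 nz] z w 1 2 ..
  qed
  \<comment> \<open>The phase that turns \<open>e k / \<mu>\<close> into the positive number \<open>k / |\<mu>|\<close>.\<close>
  have "norm (of_real e * \<mu> / of_real m) = 1"
    using e m by (auto simp: norm_mult norm_divide m_def[symmetric])
  then have "a * Re (of_real (e * k) / \<mu> * (of_real e * \<mu> / of_real m)) \<le> 2 * Re (of_real \<alpha>) - 2 + c"
    unfolding a_def using positive_jet[OF P[unfolded J]] ne by blast
  also have "of_real (e * k) / \<mu> * (of_real e * \<mu> / of_real m) = complex_of_real ((e * e) * k / m)"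
    using \<mu>0 by (simp add: field_simps)
  finally show ?thesis
    by (simp add: ee \<alpha>_def k_def m_def)
qed

text \<open>
  The limit \<open>t \<rightarrow> 1\<close>. It is taken after clearing denominators, since \<open>s\<close> or \<open>r\<close> may
  be \<open>1\<close>; in that case \<open>p = 0\<close> for one of the signs, while the left-hand side is
  positive. This excludes a nontrivial Jordan block with eigenvalue on the
  boundary of the annulus.
\<close>

lemma DLA_jet_boundary_inequality:
  fixes R c e :: real and \<mu> P Q :: complex
  defines "s \<equiv> norm \<mu> / R" and "r \<equiv> 1 / (R * norm \<mu>)"
  defines "p \<equiv> (1 - e * s) * (1 + e * r)" and "A \<equiv> ((norm P)\<^sup>2 + (norm Q)\<^sup>2) / norm \<mu>"
  assumes R: "R > 1" and \<mu>: "1 / R \<le> norm \<mu>" "norm \<mu> \<le> R"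
    and T: "jet (nilpotent2 P Q) \<mu> 1 \<in> DLA R c" and ne: "P \<noteq> 0 \<or> Q \<noteq> 0"
    and e: "e = 1 \<or> e = - 1"
  shows "A * (s + r) * (1 + s * r) \<le> 2 * (1 + s * r) * p + c * p\<^sup>2"
proof -
  define F where "F = (\<lambda>t. 2 * (1 + (e * t * s) * (e * t * r)) * ((1 - e * t * s) * (1 + e * t * r))
      + c * ((1 - e * t * s) * (1 + e * t * r))\<^sup>2
      - e * A * (e * t * s + e * t * r) * (1 + (e * t * s) * (e * t * r)))"
  have m: "0 < norm \<mu>" using \<mu> R by (auto intro: less_le_trans[of 0 "1 / R"])
  have sr: "0 < s" "s \<le> 1" "0 < r" "r \<le> 1"
    using R m \<mu> by (auto simp: s_def r_def field_simps)
  have ee: "e * e = 1" using e by auto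
  have F0: "0 \<le> F t" if t: "0 < t" "t < 1" for t
  proof -
    have small: "t * s < 1" "t * r < 1"
      using sr t by (smt (verit) mult_left_le)+
    have x: "e * t * s < 1" and y: "- 1 < e * t * r"
      using e small sr t by (auto simp: mult_pos_pos less_trans[of _ 0])
    have "e * A * (e * t * s / (1 - e * t * s)\<^sup>2 + e * t * r / (1 + e * t * r)\<^sup>2)
       = (e * e) * (A * (t * s / (1 - e * t * s)\<^sup>2 + t * r / (1 + e * t * r)\<^sup>2))"
      by (simp add: algebra_simps)
    also have "\<dots> \<le> 2 / (1 - e * t * s) + 2 / (1 + e * t * r) - 2 + c"
      unfolding ee A_def s_def r_def using DLA_jet_inequality[OF R \<mu> T ne e t] by simp
    finally show ?thesis
      using two_poles_inequality[OF x y] unfolding F_def by simp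
  qed
  have "(F \<longlongrightarrow> F 1) (at_left 1)"
    unfolding F_def by (intro tendsto_intros)
  moreover have "eventually (\<lambda>t. 0 \<le> F t) (at_left 1)"
    by (rule eventually_at_leftI[of 0]) (use F0 in auto)
  ultimately have "0 \<le> F 1"
    by (rule tendsto_lowerbound) simp
  also have "F 1 = 2 * (1 + (e * e) * (s * r)) * p + c * p\<^sup>2 - (e * e) * (A * (s + r) * (1 + (e * e) * (s * r)))"
    by (simp add: F_def p_def algebra_simps)
  finally show ?thesis by (simp add: ee)
qed

text \<open>
  Put \<open>D = A (s + r)\<close>, \<open>p = (1 - s) (1 + r)\<close> and \<open>q = (1 + s) (1 - r)\<close>. The hypotheses
  divide to \<open>D / p \<le> 2 + c p / (1 + s r)\<close> and \<open>D / q \<le> 2 + c q / (1 + s r)\<close>, and the claim is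
  their arithmetic mean: \<open>(p + q) / 2 = 1 - s r\<close> and \<open>p q = (1 - s\<^sup>2) (1 - r\<^sup>2)\<close>.
\<close>

lemma averaged_inequality:
  fixes A c s r :: real
  assumes sr: "0 < s" "s < 1" "0 < r" "r < 1"
    and p: "A * (s + r) * (1 + s * r) \<le> 2 * (1 + s * r) * ((1 - s) * (1 + r)) + c * ((1 - s) * (1 + r))\<^sup>2"
    and q: "A * (s + r) * (1 + s * r) \<le> 2 * (1 + s * r) * ((1 + s) * (1 - r)) + c * ((1 + s) * (1 - r))\<^sup>2"
  shows "A * (s / (1 - s\<^sup>2) + r / (1 - r\<^sup>2)) \<le> 2 + c * ((1 - s * r) / (1 + s * r))"
proof -
  define D where "D = A * (s + r)"
  define u where "u = 1 + s * r"
  have u: "0 < u" using sr by (simp add: u_def add_pos_pos)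
  have half: "D / v \<le> 2 + c * v / u" if "0 < v" "D * u \<le> 2 * u * v + c * v\<^sup>2" for v
  proof -
    have "D / v = D * u / (u * v)" using u that by simp
    also have "\<dots> \<le> (2 * u * v + c * v\<^sup>2) / (u * v)" using u that by (intro divide_right_mono) auto
    also have "\<dots> = 2 + c * v / u" using u that by (simp add: field_simps power2_eq_square)
    finally show ?thesis .
  qed
  define P where "P = (1 - s) * (1 + r)"
  define Q where "Q = (1 + s) * (1 - r)"
  have PQ: "0 < P" "0 < Q" using sr by (auto simp: P_def Q_def)
  have "P + Q = 2 * (1 - s * r)" by (simp add: P_def Q_def algebra_simps)
  then have mean: "(P + Q) / 2 = 1 - s * r" by simp
  have "s / (1 - s\<^sup>2) + r / (1 - r\<^sup>2) = (s + r) * ((P + Q) / 2) / (P * Q)"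
  proof -
    have "1 - s\<^sup>2 = (1 - s) * (1 + s)" "1 - r\<^sup>2 = (1 - r) * (1 + r)"
      by (simp_all add: power2_eq_square algebra_simps)
    moreover have "s / ((1 - s) * (1 + s)) + r / ((1 - r) * (1 + r)) = (s + r) * (1 - s * r) / (P * Q)"
    proof -
      have "s / ((1 - s) * (1 + s)) + r / ((1 - r) * (1 + r))
        = (s * ((1 - r) * (1 + r)) + r * ((1 - s) * (1 + s))) / (((1 - s) * (1 + s)) * ((1 - r) * (1 + r)))"
        using sr by (intro add_frac_eq) auto
      also have "s * ((1 - r) * (1 + r)) + r * ((1 - s) * (1 + s)) = (s + r) * (1 - s * r)"
        by (simp add: algebra_simps)
      also have "((1 - s) * (1 + s)) * ((1 - r) * (1 + r)) = P * Q" by (simp add: P_def Q_def)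
      finally show ?thesis .
    qed
    ultimately show ?thesis by (simp only: mean)
  qed
  then have "A * (s / (1 - s\<^sup>2) + r / (1 - r\<^sup>2)) = A * ((s + r) * ((P + Q) / 2) / (P * Q))"
    by (simp only:)
  also have "\<dots> = (D / P + D / Q) / 2"
    using PQ by (simp add: D_def field_simps)
  also have "\<dots> \<le> ((2 + c * P / u) + (2 + c * Q / u)) / 2"
    using half[of P] half[of Q] PQ p q by (intro divide_right_mono add_mono) (auto simp: D_def P_def Q_def u_def)
  also have "\<dots> = 2 + c * (((P + Q) / 2) / u)"
    by (simp add: add_divide_distrib distrib_left)
  also have "\<dots> = 2 + c * ((1 - s * r) / (1 + s * r))"
    by (simp only: mean u_def)
  finally show ?thesis .
qed

text \<open>
  The weight in the Schwarz-Pick estimate is \<open>(s / (1 - s\<^sup>2) + r / (1 - r\<^sup>2)) / |\<mu>|\<close> for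
  \<open>s = |\<mu>| / R\<close> and \<open>r = 1 / (R |\<mu>|)\<close>, which is what the averaged positivity condition
  controls. Since \<open>s r = 1 / R\<^sup>2\<close>, the constant does not depend on \<open>\<mu>\<close>.
\<close>

lemma DLA_jet_derivative_bound:
  fixes R c :: real and \<mu> P Q :: complex
  assumes R: "R > 1" and c: "c \<ge> 0" and \<mu>: "1 / R \<le> norm \<mu>" "norm \<mu> \<le> R"
    and T: "jet (nilpotent2 P Q) \<mu> 1 \<in> DLA R c"
    and U: "open U" "closed_annulus R \<subseteq> U" and hol: "f holomorphic_on U"
    and bd: "\<And>z. z \<in> closed_annulus R \<Longrightarrow> norm (f z) < 1"
  shows "((norm P)\<^sup>2 + (norm Q)\<^sup>2) * norm (deriv f \<mu>)
      \<le> (2 + c * ((R\<^sup>2 - 1) / (R\<^sup>2 + 1))) * (1 - (norm (f \<mu>))\<^sup>2)"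
    (is "?a * _ \<le> ?K * _")
proof -
  have K: "0 \<le> ?K" using R c by (intro add_nonneg_nonneg mult_nonneg_nonneg divide_nonneg_nonneg) auto
  have "norm (f \<mu>) < 1" using bd \<mu> by (simp add: closed_annulus_def)
  then have f1: "0 < 1 - (norm (f \<mu>))\<^sup>2" by (simp add: abs_square_less_1)
  show ?thesis
  proof (cases "P = 0 \<and> Q = 0")
    case True
    then show ?thesis using K f1 by simp
  next
    case False
    then have ne: "P \<noteq> 0 \<or> Q \<noteq> 0" by simp
    define m where "m = norm \<mu>"
    define s where "s = m / R"
    define r where "r = 1 / (R * m)"
    define A where "A = ?a / m"
    have m: "0 < m" using \<mu> R by (auto simp: m_def intro: less_le_trans[of 0 "1 / R"])
    have sr: "0 < s" "s \<le> 1" "0 < r" "r \<le> 1"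
      using R m \<mu> by (auto simp: s_def r_def m_def[symmetric] field_simps)
    have "0 < ?a" using ne by (auto simp: add_nonneg_pos add_pos_nonneg)
    then have A: "0 < A" using m by (simp add: A_def)
    have p: "A * (s + r) * (1 + s * r) \<le> 2 * (1 + s * r) * ((1 - s) * (1 + r)) + c * ((1 - s) * (1 + r))\<^sup>2"
      using DLA_jet_boundary_inequality[OF R \<mu> T ne, of 1]
      by (simp add: A_def s_def r_def m_def)
    have q: "A * (s + r) * (1 + s * r) \<le> 2 * (1 + s * r) * ((1 + s) * (1 - r)) + c * ((1 + s) * (1 - r))\<^sup>2"
      using DLA_jet_boundary_inequality[OF R \<mu> T ne, of "- 1"]
      by (simp add: A_def s_def r_def m_def)
    have "0 < A * (s + r) * (1 + s * r)" using A sr by (intro mult_pos_pos add_pos_pos) auto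
    then have "s \<noteq> 1" "r \<noteq> 1" using p q by auto
    then have sr1: "s < 1" "r < 1" using sr by auto
    then have \<mu>': "1 / R < norm \<mu>" "norm \<mu> < R"
      using R m by (auto simp: s_def r_def m_def[symmetric] field_simps)
    have srR: "s * r = 1 / R\<^sup>2" using m by (simp add: s_def r_def power2_eq_square)
    have "1 - s * r = (R\<^sup>2 - 1) / R\<^sup>2" "1 + s * r = (R\<^sup>2 + 1) / R\<^sup>2"
      using R by (simp_all add: srR diff_divide_distrib add_divide_distrib)
    then have "(1 - s * r) / (1 + s * r) = (R\<^sup>2 - 1) / (R\<^sup>2 + 1)"
      using R by simp
    then have bound: "A * (s / (1 - s\<^sup>2) + r / (1 - r\<^sup>2)) \<le> ?K"
      using averaged_inequality[OF sr(1) sr1(1) sr(3) sr1(2) p q] by simp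
    let ?L = "R / (R\<^sup>2 - m\<^sup>2) + (1 / R) / (m\<^sup>2 - (1 / R)\<^sup>2)"
    have L: "?a * ?L = A * (s / (1 - s\<^sup>2) + r / (1 - r\<^sup>2))"
    proof -
      have "1 - s\<^sup>2 = (R\<^sup>2 - m\<^sup>2) / R\<^sup>2"
        using R by (simp add: s_def power_divide diff_divide_distrib)
      then have s: "s / (1 - s\<^sup>2) = m * (R / (R\<^sup>2 - m\<^sup>2))"
        using R by (simp add: s_def power2_eq_square)
      have "1 - r\<^sup>2 = (m\<^sup>2 - (1 / R)\<^sup>2) / m\<^sup>2"
        using m by (simp add: r_def power_divide power_mult_distrib diff_divide_distrib)
      then have r: "r / (1 - r\<^sup>2) = m * ((1 / R) / (m\<^sup>2 - (1 / R)\<^sup>2))"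
        using m by (simp add: r_def power2_eq_square)
      have "?a * ?L = A * (m * ?L)" using m by (simp add: A_def)
      also have "m * ?L = s / (1 - s\<^sup>2) + r / (1 - r\<^sup>2)" by (simp only: s r distrib_left)
      finally show ?thesis .
    qed
    have "norm (deriv f \<mu>) \<le> (1 - (norm (f \<mu>))\<^sup>2) * ?L"
      unfolding m_def
      by (rule annulus_schwarz_pick[OF R \<mu>' U hol bd])
    then have "?a * norm (deriv f \<mu>) \<le> ?a * ((1 - (norm (f \<mu>))\<^sup>2) * ?L)"
      by (intro mult_left_mono) auto
    also have "\<dots> = (?a * ?L) * (1 - (norm (f \<mu>))\<^sup>2)" by (simp only: mult_ac)
    also have "\<dots> \<le> ?K * (1 - (norm (f \<mu>))\<^sup>2)"
      unfolding L using bound f1 by (intro mult_right_mono) auto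
    finally show ?thesis .
  qed
qed

lemma compact_closed_annulus: "compact (closed_annulus R)"
proof -
  have "closed_annulus R = cball 0 R - ball 0 (1 / R)"
    by (auto simp: closed_annulus_def)
  then show ?thesis by (simp add: compact_diff)
qed

lemma norm_scale_vec: "norm (k *s h) = norm k * norm (h :: complex ^ 'n)"
  by (simp add: norm_vec_def L2_set_def norm_mult power_mult_distrib sum_distrib_left[symmetric]
      real_sqrt_mult)

section \<open>The spectral constant\<close>

theorem theorem1p3:
  fixes R c :: real and T :: "complex ^ 2 ^ 2"
  assumes "R > 1" and "c \<ge> 0"
    and "T \<in> DLA R c"
    and "\<exists>!\<mu>. is_eigenvalue T \<mu>"
  shows "K_spectral_set (closed_annulus R) (2 + c * ((R\<^sup>2 - 1) / (R\<^sup>2 + 1))) T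
    \<and> 2 + c * ((R\<^sup>2 - 1) / (R\<^sup>2 + 1)) \<le> 2 + c"
proof
  have "(R\<^sup>2 - 1) / (R\<^sup>2 + 1) \<le> 1" by (simp add: divide_le_eq_1 add_pos_nonneg add_nonneg_pos)
  then show "2 + c * ((R\<^sup>2 - 1) / (R\<^sup>2 + 1)) \<le> 2 + c"
    using mult_left_mono[of "(R\<^sup>2 - 1) / (R\<^sup>2 + 1)" 1 c] assms(2) by simp
next
  let ?X = "closed_annulus R"
  define K where "K = 2 + c * ((R\<^sup>2 - 1) / (R\<^sup>2 + 1))"
  have "0 \<le> c * ((R\<^sup>2 - 1) / (R\<^sup>2 + 1))"
    using assms by (intro mult_nonneg_nonneg divide_nonneg_nonneg) auto
  then have K: "1 < K" by (simp add: K_def)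
  obtain \<mu> P Q where T: "T = jet (nilpotent2 P Q) \<mu> 1" and \<mu>: "\<mu> \<in> spectrum T"
    using single_eigenvalue_jet[OF assms(4)] by metis
  have sp: "spectrum T \<subseteq> ?X" using assms(3) by (simp add: DLA_def)
  then have \<mu>X: "\<mu> \<in> ?X" using \<mu> by blast
  then have \<mu>R: "1 / R \<le> norm \<mu>" "norm \<mu> \<le> R" by (auto simp: closed_annulus_def)
  have "onorm ((*v) (poly_mat p T ** matrix_inv (poly_mat q T)))
      \<le> K * (SUP z\<in>?X. norm (poly p z / poly q z))" if q: "\<forall>z\<in>?X. poly q z \<noteq> 0" for p q
  proof -
    define f where "f = (\<lambda>z. poly p z / poly q z)"
    define M where "M = (SUP z\<in>?X. norm (f z))"
    define U where "U = {z. poly q z \<noteq> 0}"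
    have U: "open U" "?X \<subseteq> U"
      unfolding U_def using q by (auto intro!: open_Collect_neq continuous_intros)
    have hol: "f holomorphic_on U"
      unfolding f_def U_def by (intro holomorphic_intros) auto
    have "continuous_on ?X (\<lambda>z. norm (f z))"
      by (intro continuous_on_norm holomorphic_on_imp_continuous_on holomorphic_on_subset[OF hol U(2)])
    then have bdd: "bdd_above ((\<lambda>z. norm (f z)) ` ?X)"
      by (intro bounded_imp_bdd_above compact_imp_bounded compact_continuous_image compact_closed_annulus)
    have M: "norm (f z) \<le> M" if "z \<in> ?X" for z
      unfolding M_def using bdd that by (rule cSUP_upper2) auto
    have M0: "0 \<le> M" using M[OF \<mu>X] norm_ge_zero order_trans by blast
    define B where "B = jet (nilpotent2 P Q) (f \<mu>) (deriv f \<mu>)"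
    have fT: "poly_mat p T ** matrix_inv (poly_mat q T) = B"
      unfolding T B_def f_def using q \<mu>X by (intro rational_mat_jet nilpotent2_square) auto
    \<comment> \<open>The Schwarz-Pick estimate needs a strict bound, so \<open>f\<close> is divided by any \<open>M' > M\<close>.\<close>
    have "onorm ((*v) B) / K \<le> M'" if M': "M < M'" for M'
    proof -
      have M'0: "0 < M'" using M' M0 by simp
      define g where "g = (\<lambda>z. f z / of_real M')"
      have g: "g holomorphic_on U" unfolding g_def using M'0 by (intro holomorphic_intros hol) auto
      have g1: "norm (g z) < 1" if "z \<in> ?X" for z
        using M[OF that] M' M'0 by (simp add: g_def norm_divide)
      have dg: "deriv g \<mu> = deriv f \<mu> / of_real M'"
        unfolding g_def using hol U \<mu>X by (intro deriv_cdivide_right) (auto simp: holomorphic_on_open field_differentiable_def)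
      have "((norm P)\<^sup>2 + (norm Q)\<^sup>2) * norm (deriv g \<mu>) \<le> K * (1 - (norm (g \<mu>))\<^sup>2)"
        unfolding K_def using assms(1,2) \<mu>R assms(3)[unfolded T] U g g1
        by (rule DLA_jet_derivative_bound)
      then have J: "norm (jet (nilpotent2 P Q) (g \<mu>) (deriv g \<mu>) *v h) \<le> K * norm h" for h
        using g1[OF \<mu>X] K by (intro jet_norm_bound) auto
      have "B = mat (of_real M') ** jet (nilpotent2 P Q) (g \<mu>) (deriv g \<mu>)"
        unfolding jet_scalar B_def dg using M'0 by (simp add: g_def)
      then have "B *v h = of_real M' *s (jet (nilpotent2 P Q) (g \<mu>) (deriv g \<mu>) *v h)" for h
        by (simp add: matrix_vector_mul_assoc[symmetric] mat_vec_mult)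
      then have "norm (B *v h) \<le> M' * (K * norm h)" for h
        using J[of h] M'0 by (simp add: norm_scale_vec)
      then have "onorm ((*v) B) \<le> M' * K"
        using M'0 K by (intro onorm_bound) (auto simp: mult.assoc)
      then show ?thesis using K by (simp add: divide_le_eq)
    qed
    then have "onorm ((*v) B) / K \<le> M" by (rule dense_ge)
    then show ?thesis
      using K unfolding fT M_def f_def by (simp add: divide_le_eq mult.commute)
  qed
  then show "K_spectral_set ?X (2 + c * ((R\<^sup>2 - 1) / (R\<^sup>2 + 1))) T"
    unfolding K_spectral_set_def K_def[symmetric] using compact_closed_annulus sp by blast
qed

end
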